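(* Let $\Omega\subset\mathbb{R}^d$ be a bounded domain with Lipschitz boundary and diameter $D$. For a given vector $\boldsymbol\xi\in\mathbb{R}^d$ and $c\in\mathbb{R}$, assume that the hyper-plane $\boldsymbol\xi\cdot\mathbf{x}=c$ divides $\Omega$ into two non-empty subdomains $\Omega_1=\{\mathbf{x}\in\Omega:\boldsymbol\xi\cdot\mathbf{x}<c\}$ and $\Omega_2=\{\mathbf{x}\in\Omega:\boldsymbol\xi\cdot\mathbf{x}>c\}$. Let $\alpha_1,\alpha_2\in\mathbb{R}$, and let $\chi$ be the piece-wise constant function equal to $\alpha_1$ on $\Omega_1$ and $\alpha_2$ on $\Omega_2$. Let $p$ be the two-layer neural network function given by $$p(\mathbf{x})=\alpha_1+\frac{\alpha_2-\alpha_1}{2\varepsilon}\Big(\sigma(\boldsymbol\xi\cdot\mathbf{x}-c+\varepsilon)-\sigma(\boldsymbol\xi\cdot\mathbf{x}-c-\varepsilon)\Big)$$ for any $\varepsilon>0$ such that the intersections between $\Omega$ and the hyper-planes $\boldsymbol\xi\cdot\mathbf{x}=c\pm\varepsilon$ are not empty. Then $$\|\chi-p\|_{L^2(\Omega)}=\left(\|\chi-p\|_{L^2(\Omega)}^2+\|\chi_{\boldsymbol\eta}-p_{\boldsymbol\eta}\|_{L^2(\Omega)}^2\right)^{1/2}\le\frac{1}{\sqrt6}\,D^{(d-1)/2}\,|\alpha_1-\alpha_2|\,\sqrt{\varepsilon},$$ where $\boldsymbol\eta$ is a vector normal to $\boldsymbol\xi$.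
   Context: $\sigma(t)=\max\{0,t\}$ is the ReLU activation function. For a vector $\boldsymbol\eta$, $v_{\boldsymbol\eta}=\boldsymbol\eta\cdot\nabla v$ denotes the directional derivative of $v$ along $\boldsymbol\eta$; $\boldsymbol\eta$ normal to $\boldsymbol\xi$ means $\boldsymbol\eta\cdot\boldsymbol\xi=0$.
   Formalization: The formal statement assumes in addition that the vector ξ has norm at least 1, since the printed bound fails for shorter ξ (e.g. d=1, Ω=(0,1), ξ=1/10, c=1/20, ε=1/25, α₁=0, α₂=1); the derivatives along η are taken in the weak sense. *)

theory Defs
  imports "HOL-Analysis.Analysis"
begin

definition relu :: "real \<Rightarrow> real" where
  "relu t = max 0 t"

text \<open>Near each boundary point, after a rigid change of coordinates with last axis \<open>u\<close>, the set
  is the part of a ball above the graph of a Lipschitz function \<open>\<gamma>\<close> of the remaining coordinates,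
  that is, of a function on the hyperplane orthogonal to \<open>u\<close>.\<close>

definition lipschitz_boundary :: "(real ^ 'n) set \<Rightarrow> bool" where
  "lipschitz_boundary \<Omega> \<longleftrightarrow>
     (\<forall>z\<in>frontier \<Omega>. \<exists>r>0. \<exists>u L. \<exists>\<gamma> :: real ^ 'n \<Rightarrow> real.
        norm u = 1 \<and> L-lipschitz_on {y. y \<bullet> u = 0} \<gamma> \<and>
        \<Omega> \<inter> ball z r = {x \<in> ball z r. x \<bullet> u > \<gamma> (x - (x \<bullet> u) *\<^sub>R u)})"

definition bounded_lipschitz_domain :: "(real ^ 'n) set \<Rightarrow> bool" where
  "bounded_lipschitz_domain \<Omega> \<longleftrightarrow>
     open \<Omega> \<and> connected \<Omega> \<and> \<Omega> \<noteq> {} \<and> bounded \<Omega> \<and> lipschitz_boundary \<Omega>"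

text \<open>The completed measure \<open>lebesgue\<close> is used throughout, so that changing a function on a
  Lebesgue null set affects neither measurability nor integrals.\<close>

definition square_integrable :: "(real ^ 'n) set \<Rightarrow> (real ^ 'n \<Rightarrow> real) \<Rightarrow> bool" where
  "square_integrable \<Omega> f \<longleftrightarrow>
     set_borel_measurable lebesgue \<Omega> f \<and> set_integrable lebesgue \<Omega> (\<lambda>x. (f x)\<^sup>2)"

text \<open>Meaningful only for square integrable functions: the Bochner integral of a non-integrable
  function is 0.\<close>

definition L2_norm :: "(real ^ 'n) set \<Rightarrow> (real ^ 'n \<Rightarrow> real) \<Rightarrow> real" where
  "L2_norm \<Omega> f = sqrt (LINT x:\<Omega>|lebesgue. (f x)\<^sup>2)"

primrec Ck :: "nat \<Rightarrow> (real ^ 'n \<Rightarrow> real) \<Rightarrow> bool" where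
  "Ck 0 f \<longleftrightarrow> continuous_on UNIV f"
| "Ck (Suc k) f \<longleftrightarrow>
     (\<forall>x. f differentiable (at x)) \<and> (\<forall>v. Ck k (\<lambda>x. frechet_derivative f (at x) v))"

definition test_function :: "(real ^ 'n) set \<Rightarrow> (real ^ 'n \<Rightarrow> real) \<Rightarrow> bool" where
  "test_function \<Omega> \<phi> \<longleftrightarrow>
     (\<forall>k. Ck k \<phi>) \<and> compact (closure {x. \<phi> x \<noteq> 0}) \<and> closure {x. \<phi> x \<noteq> 0} \<subseteq> \<Omega>"

definition locally_integrable :: "(real ^ 'n) set \<Rightarrow> (real ^ 'n \<Rightarrow> real) \<Rightarrow> bool" where
  "locally_integrable \<Omega> v \<longleftrightarrow> (\<forall>K. compact K \<and> K \<subseteq> \<Omega> \<longrightarrow> set_integrable lebesgue K v)"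

text \<open>\<open>w\<close> is (a version of) the directional derivative of \<open>v\<close> along the constant vector \<open>\<eta>\<close> on
  \<open>\<Omega>\<close>. The derivative is taken in the weak sense because it is applied to discontinuous functions:
  a jump across a hyperplane is invisible to the almost-everywhere classical derivative, whatever
  the direction, whereas it is an obstruction to a weak derivative unless \<open>\<eta>\<close> is tangential.\<close>

definition has_weak_directional_derivative ::
  "(real ^ 'n) set \<Rightarrow> real ^ 'n \<Rightarrow> (real ^ 'n \<Rightarrow> real) \<Rightarrow> (real ^ 'n \<Rightarrow> real) \<Rightarrow> bool" where
  "has_weak_directional_derivative \<Omega> \<eta> v w \<longleftrightarrow>
     locally_integrable \<Omega> v \<and> locally_integrable \<Omega> w \<and>
     (\<forall>\<phi>. test_function \<Omega> \<phi> \<longrightarrow>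
        (LINT x:\<Omega>|lebesgue. v x * frechet_derivative \<phi> (at x) \<eta>)
          = - (LINT x:\<Omega>|lebesgue. w x * \<phi> x))"

end

theory Submission
  imports Defs
begin

text \<open>Both \<open>\<chi>\<close> and \<open>p\<close> agree almost everywhere on \<open>\<Omega>\<close> with ridge functions \<open>g (\<xi> \<bullet> x)\<close>. Translating along
  \<open>\<eta> \<bottom> \<xi>\<close> leaves such a function unchanged, so integrating it against a difference quotient
  \<open>(\<phi> (x + h \<eta>) - \<phi> x) / h\<close> gives 0, and \<open>h \<rightarrow> 0\<close> shows that 0 is a weak derivative along \<open>\<eta>\<close>; by the
  fundamental lemma of the calculus of variations it is the only one up to null sets. The \<open>L\<^sup>2\<close>
  bound comes from rotating \<open>\<xi>\<close> onto a coordinate axis: the rotated \<open>\<Omega>\<close> lies in a box of side \<open>D\<close>, and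
  across the layer \<open>(\<chi> - p)\<^sup>2\<close> is \<open>(\<alpha>\<^sub>1 - \<alpha>\<^sub>2)\<^sup>2 / 4 * (1 - \<bar>t\<bar> / \<epsilon>)\<^sup>2\<close>, whose integral over \<open>\<bar>t\<bar> \<le> \<epsilon>\<close> is
  \<open>(\<alpha>\<^sub>1 - \<alpha>\<^sub>2)\<^sup>2 * \<epsilon> / 6\<close>.\<close>

section \<open>Smooth bump functions\<close>

lemma frechet_derivative_eqI:
  "(f has_derivative f') (at x) \<Longrightarrow> frechet_derivative f (at x) = f'"
  using frechet_derivative_at by metis

lemma Ck_SucI:
  assumes "\<And>x. (f has_derivative f' x) (at x)" and "\<And>v. Ck k (\<lambda>x. f' x v)"
  shows "Ck (Suc k) f"
proof -
  have "frechet_derivative f (at x) = f' x" for x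
    using assms(1) by (rule frechet_derivative_eqI)
  then show ?thesis
    using assms unfolding Ck.simps differentiable_def by auto
qed

lemma Ck_Suc_has_derivative:
  "Ck (Suc k) f \<Longrightarrow> (f has_derivative frechet_derivative f (at x)) (at x)"
  by (simp add: frechet_derivative_works)

text \<open>The product rule leaves one factor undifferentiated, so \<open>Ck_mult\<close> has to
  lower the order of that factor by one.\<close>

lemma Ck_Suc_imp_Ck: "Ck (Suc k) f \<Longrightarrow> Ck k f"
proof (induction k arbitrary: f)
  case 0
  then show ?case
    by (auto intro!: differentiable_imp_continuous_on simp: differentiable_on_def
          intro: differentiable_at_withinI)
next
  case (Suc k)
  then show ?case by (metis Ck.simps(2))
qed

lemma Ck_const: "Ck k (\<lambda>x. a)"
proof (induction k arbitrary: a)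
  case (Suc k)
  show ?case by (rule Ck_SucI[where f' = "\<lambda>_ _. 0"]) (auto simp: Suc)
qed simp

lemma Ck_add: "Ck k f \<Longrightarrow> Ck k g \<Longrightarrow> Ck k (\<lambda>x. f x + g x)"
proof (induction k arbitrary: f g)
  case 0
  then show ?case by (auto intro: continuous_intros)
next
  case (Suc k)
  show ?case
    by (rule Ck_SucI[OF has_derivative_add[OF Suc.prems[THEN Ck_Suc_has_derivative]]])
      (use Suc in auto)
qed

lemma Ck_mult: "Ck k f \<Longrightarrow> Ck k g \<Longrightarrow> Ck k (\<lambda>x. f x * g x)"
proof (induction k arbitrary: f g)
  case 0
  then show ?case by (auto intro: continuous_intros)
next
  case (Suc k)
  show ?case
    by (rule Ck_SucI[OF has_derivative_mult[OF Suc.prems[THEN Ck_Suc_has_derivative]]],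
        rule Ck_add; rule Suc.IH)
      (use Suc.prems[THEN Ck_Suc_imp_Ck] Suc.prems in auto)
qed

lemma Ck_prod: "finite I \<Longrightarrow> (\<And>i. i \<in> I \<Longrightarrow> Ck k (f i)) \<Longrightarrow> Ck k (\<lambda>x. \<Prod>i\<in>I. f i x)"
  by (induction rule: finite_induct) (auto intro: Ck_const Ck_mult)

text \<open>\<open>G m\<close> stands for the \<open>m\<close>-th derivative of \<open>G 0\<close>.\<close>

lemma Ck_ridge:
  fixes G :: "nat \<Rightarrow> real \<Rightarrow> real"
  assumes G: "\<And>m t. (G m has_real_derivative G (Suc m) t) (at t)"
  shows "Ck k (\<lambda>x. G m (a \<bullet> x + b))"
proof (induction k arbitrary: m)
  case 0
  have "continuous_on UNIV (G m)"
    using G by (meson DERIV_isCont continuous_at_imp_continuous_on)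
  then show ?case
    by (auto intro!: continuous_intros intro: continuous_on_compose2)
next
  case (Suc k)
  have "((\<lambda>x. G m (a \<bullet> x + b)) has_derivative (\<lambda>v. G (Suc m) (a \<bullet> x + b) * (a \<bullet> v))) (at x)" for x
    by (rule has_derivative_eq_rhs,
        rule has_derivative_compose[OF _ G[unfolded has_field_derivative_def]])
      (auto intro!: derivative_eq_intros)
  \<comment> \<open>For fixed \<open>v\<close> the derivative is the next function of the family
    times the constant \<open>a \<bullet> v\<close>; hence the induction treats all \<open>m\<close>
    at once.\<close>
  then show ?case
    by (rule Ck_SucI) (intro Ck_mult Suc Ck_const)
qed

text \<open>The functions \<open>P (1 / t) * exp (- 1 / t)\<close>, extended by 0, are closed under differentiation.\<close>

definition flat_poly :: "real poly \<Rightarrow> real \<Rightarrow> real" where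
  "flat_poly P t = (if t > 0 then poly P (1 / t) * exp (- (1 / t)) else 0)"

lemma poly_times_exp_tendsto_0:
  fixes P :: "real poly"
  shows "((\<lambda>s. poly P s * exp (- s)) \<longlongrightarrow> 0) at_top"
proof -
  have "((\<lambda>s. \<Sum>i\<le>degree P. coeff P i * (s ^ i / exp s)) \<longlongrightarrow> (\<Sum>i\<le>degree P. coeff P i * 0)) at_top"
    by (intro tendsto_intros tendsto_power_div_exp_0)
  then show ?thesis
    by (simp add: poly_altdef sum_distrib_right exp_minus divide_inverse mult.assoc)
qed

text \<open>With s = 1 / t the chain rule gives (P'(s) - P(s)) exp(-s) times -s^2, hence the new
  polynomial X^2 (P - P'). At 0 the exponential decay beats every power of s.\<close>

lemma flat_poly_has_derivative:
  "(flat_poly P has_real_derivative flat_poly (monom 1 2 * (P - pderiv P)) t) (at t)"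
proof -
  consider "t > 0" | "t < 0" | "t = 0" by linarith
  then show ?thesis
  proof cases
    case 1
    have "((\<lambda>t. poly P (1 / t) * exp (- (1 / t))) has_real_derivative
        flat_poly (monom 1 2 * (P - pderiv P)) t) (at t)"
      using 1 unfolding flat_poly_def
      by (auto intro!: derivative_eq_intros poly_DERIV[THEN DERIV_chain2]
           simp: poly_monom field_simps power2_eq_square)
    then show ?thesis
      by (rule has_field_derivative_transform_within_open[where S = "{0<..}"])
        (use 1 in \<open>auto simp: flat_poly_def\<close>)
  next
    case 2
    have "((\<lambda>t. 0) has_real_derivative flat_poly (monom 1 2 * (P - pderiv P)) t) (at t)"
      using 2 by (simp add: flat_poly_def)
    then show ?thesis
      by (rule has_field_derivative_transform_within_open[where S = "{..<0}"])
        (use 2 in \<open>auto simp: flat_poly_def\<close>)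
  next
    case 3
    \<comment> \<open>The factor \<open>monom 1 1\<close> absorbs the division by \<open>h\<close>
      in the difference quotient at 0.\<close>
    have "((\<lambda>h. poly (monom 1 1 * P) (inverse h) * exp (- inverse h)) \<longlongrightarrow> 0) (at_right 0)"
      by (rule filterlim_compose[OF poly_times_exp_tendsto_0 filterlim_inverse_at_top_right])
    then have R: "((\<lambda>h. flat_poly P h / h) \<longlongrightarrow> 0) (at_right 0)"
      by (rule Lim_transform_eventually)
        (auto simp: eventually_at_filter flat_poly_def poly_monom divide_inverse)
    have L: "((\<lambda>h. flat_poly P h / h) \<longlongrightarrow> 0) (at_left 0)"
      by (rule Lim_transform_eventually[of "\<lambda>_. 0"])
        (auto simp: eventually_at_filter flat_poly_def)
    have "((\<lambda>h. flat_poly P h / h) \<longlongrightarrow> 0) (at 0)"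
      using L R by (simp add: filterlim_split_at)
    then show ?thesis
      using 3 by (simp add: DERIV_def flat_poly_def)
  qed
qed

definition flat_exp :: "real \<Rightarrow> real" where
  "flat_exp = flat_poly 1"

lemma Ck_flat_exp: "Ck k (\<lambda>x. flat_exp (a \<bullet> x + b))"
proof -
  \<comment> \<open>Iterating the map of \<open>flat_poly_has_derivative\<close> from the polynomial
    1 lists all derivatives of \<open>flat_exp\<close>, as \<open>Ck_ridge\<close> requires.\<close>
  define G where "G m = flat_poly (((\<lambda>P. monom 1 2 * (P - pderiv P)) ^^ m) 1)" for m
  have "(G m has_real_derivative G (Suc m) t) (at t)" for m t
    using flat_poly_has_derivative by (simp add: G_def)
  from Ck_ridge[of G k 0 a b, OF this] show ?thesis
    by (simp add: flat_exp_def G_def)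
qed

lemma flat_exp_bounds: "0 \<le> flat_exp t" "flat_exp t \<le> 1" "flat_exp t \<noteq> 0 \<longleftrightarrow> t > 0"
  by (auto simp: flat_exp_def flat_poly_def)

lemma flat_exp_tendsto_1:
  assumes "t > 0"
  shows "(\<lambda>m. flat_exp (real (Suc m) * t)) \<longlonglongrightarrow> 1"
proof -
  have "(\<lambda>m. exp (- (inverse (real (Suc m)) * (1 / t)))) \<longlonglongrightarrow> exp (- (0 * (1 / t)))"
    by (intro tendsto_intros LIMSEQ_inverse_real_of_nat)
  then show ?thesis
    using assms by (simp add: flat_exp_def flat_poly_def divide_inverse del: of_nat_Suc)
qed

text \<open>Scaling the argument by \<open>m + 1\<close> raises \<open>exp (- 1 / t)\<close> to the power \<open>1 / (m + 1)\<close>, so the bumps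
  converge to the indicator of the box while keeping their support.\<close>

definition box_bump :: "nat \<Rightarrow> real ^ 'n \<Rightarrow> real ^ 'n \<Rightarrow> real ^ 'n \<Rightarrow> real" where
  "box_bump m a b x = (\<Prod>i\<in>Basis. flat_exp (real (Suc m) * (x \<bullet> i - a \<bullet> i)) *
                                  flat_exp (real (Suc m) * (b \<bullet> i - x \<bullet> i)))"

lemma box_bump_bounds: "\<bar>box_bump m a b x\<bar> \<le> 1"
  unfolding box_bump_def abs_prod
  by (intro prod_le_1 conjI) (auto simp: abs_mult flat_exp_bounds intro!: mult_le_one)

lemma box_bump_nonzero: "box_bump m a b x \<noteq> 0 \<longleftrightarrow> x \<in> box a b"
  by (auto simp: box_bump_def flat_exp_bounds mem_box zero_less_mult_iff simp del: of_nat_Suc)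

lemma box_bump_tendsto:
  fixes x :: "real ^ 'n"
  shows "(\<lambda>m. box_bump m a b x) \<longlonglongrightarrow> indicator (box a b) x"
proof (cases "x \<in> box a b")
  case True
  have "(\<lambda>m. box_bump m a b x) \<longlonglongrightarrow> (\<Prod>i\<in>(Basis :: (real ^ 'n) set). 1 * 1)"
    unfolding box_bump_def
    by (intro tendsto_prod tendsto_mult flat_exp_tendsto_1) (use True in \<open>auto simp: mem_box\<close>)
  then show ?thesis using True by simp
next
  case False
  then have "(\<lambda>m. box_bump m a b x) = (\<lambda>_. 0)"
    using box_bump_nonzero by blast
  then show ?thesis using False by simp
qed

lemma Ck_box_bump:
  fixes a b :: "real ^ 'n"
  shows "Ck k (box_bump m a b)"
proof -
  have "Ck k (\<lambda>x :: real ^ 'n. flat_exp (real (Suc m) * (x \<bullet> i - a \<bullet> i)))"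
    "Ck k (\<lambda>x :: real ^ 'n. flat_exp (real (Suc m) * (b \<bullet> i - x \<bullet> i)))" for i
    using Ck_flat_exp[of k "real (Suc m) *\<^sub>R i" "- real (Suc m) * (a \<bullet> i)"]
      Ck_flat_exp[of k "- real (Suc m) *\<^sub>R i" "real (Suc m) * (b \<bullet> i)"]
    by (simp_all add: algebra_simps inner_commute)
  then show ?thesis
    unfolding box_bump_def[abs_def] by (intro Ck_prod Ck_mult) auto
qed

lemma test_function_box_bump:
  assumes "cbox a b \<subseteq> \<Omega>"
  shows "test_function \<Omega> (box_bump m a b)"
proof -
  have "closure {x. box_bump m a b x \<noteq> 0} \<subseteq> cbox a b"
    unfolding box_bump_nonzero using box_subset_cbox[of a b] by (intro closure_minimal) auto
  then show ?thesis
    using assms Ck_box_bump compact_cbox unfolding test_function_def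
    by (meson closed_closure compact_Int_closed bounded_cbox bounded_subset compact_eq_bounded_closed order_trans)
qed

section \<open>The fundamental lemma of the calculus of variations\<close>

text \<open>The bumps converge to the indicator of the open box. Dominated convergence applies with
  \<open>\<bar>w\<bar>\<close> cut off to \<open>cbox a b\<close> as majorant, integrable because
  the closed box is compact.\<close>

lemma set_integral_box_eq_0:
  fixes w :: "real ^ 'n \<Rightarrow> real"
  assumes w: "locally_integrable \<Omega> w" and ab: "cbox a b \<subseteq> \<Omega>"
    and test: "\<And>\<phi>. test_function \<Omega> \<phi> \<Longrightarrow> (LINT x:\<Omega>|lebesgue. w x * \<phi> x) = 0"
  shows "(LINT x:box a b|lebesgue. w x) = 0"
proof -
  define v where "v x = indicator (cbox a b) x * w x" for x
  have v: "integrable lebesgue v"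
    using w ab unfolding locally_integrable_def set_integrable_def v_def by auto
  have bm: "box_bump m a b \<in> borel_measurable lebesgue" for m
    using Ck_box_bump[of 0 m a b] by (intro measurable_completion) (auto intro: borel_measurable_continuous_onI)
  have zero: "(\<integral>x. v x * box_bump m a b x \<partial>lebesgue) = 0" for m
  proof -
    have "(\<lambda>x. v x * box_bump m a b x) = (\<lambda>x. indicator \<Omega> x *\<^sub>R (w x * box_bump m a b x))"
    proof
      fix x
      show "v x * box_bump m a b x = indicator \<Omega> x *\<^sub>R (w x * box_bump m a b x)"
        using box_bump_nonzero[of m a b x] ab box_subset_cbox[of a b]
        by (cases "box_bump m a b x = 0") (auto simp: v_def indicator_def)
    qed
    then show ?thesis
      using test[OF test_function_box_bump[OF ab, of m]] by (simp add: set_lebesgue_integral_def)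
  qed
  have "(\<lambda>m. \<integral>x. v x * box_bump m a b x \<partial>lebesgue) \<longlonglongrightarrow> (\<integral>x. v x * indicator (box a b) x \<partial>lebesgue)"
  proof (rule integral_dominated_convergence)
    show "integrable lebesgue (\<lambda>x. \<bar>v x\<bar>)" using v by simp
    show "AE x in lebesgue. norm (v x * box_bump m a b x) \<le> \<bar>v x\<bar>" for m
      using box_bump_bounds by (intro AE_I2) (auto simp: abs_mult intro!: mult_left_le)
    show "AE x in lebesgue. (\<lambda>m. v x * box_bump m a b x) \<longlonglongrightarrow> v x * indicator (box a b) x"
      by (intro AE_I2 tendsto_intros box_bump_tendsto)
  qed (use v bm in \<open>auto intro!: borel_measurable_times borel_measurable_indicator\<close>)
  then have "(\<integral>x. v x * indicator (box a b) x \<partial>lebesgue) = 0"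
    by (simp add: zero LIMSEQ_const_iff)
  moreover have "v x * indicator (box a b) x = indicator (box a b) x *\<^sub>R w x" for x
    using box_subset_cbox[of a b] by (auto simp: v_def indicator_def)
  ultimately show ?thesis
    by (simp add: set_lebesgue_integral_def)
qed

text \<open>Open boxes form an intersection-stable generator of the Borel sets, so a Dynkin argument
  spreads the vanishing from boxes to all Borel sets; the vanishing total integral handles
  complements. The density 0 then has the same integrals as \<open>f\<close>.\<close>

lemma AE_eq_0_if_box_integrals_eq_0:
  fixes f :: "'a::euclidean_space \<Rightarrow> real"
  assumes f: "integrable lebesgue f" and total: "(\<integral>x. f x \<partial>lebesgue) = 0"
    and box: "\<And>l u. (LINT x:box l u|lebesgue. f x) = 0"
  shows "AE x in lebesgue. f x = 0"
proof (rule density_unique_real[OF f])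
  show "integrable lebesgue (\<lambda>x :: 'a. 0 :: real)" by simp
  have si: "set_integrable lebesgue A f" if "A \<in> sets lebesgue" for A
    using f that unfolding set_integrable_def by (rule integrable_mult_indicator[rotated])
  have borel: "(LINT x:A|lebesgue. f x) = 0" if "A \<in> sets borel" for A
  proof -
    let ?E = "range (\<lambda>(a, b). box a b :: 'a set)"
    have sub: "sigma_sets UNIV ?E \<subseteq> sets lebesgue"
      using sets_completionI_sets[of _ lborel] by (auto simp: borel_eq_box)
    have "Int_stable ?E"
      by (auto simp: Int_stable_def box_Int_box)
    moreover have "?E \<subseteq> Pow UNIV" by simp
    moreover have "A \<in> sigma_sets UNIV ?E"
      using that by (simp add: borel_eq_box)
    ultimately show ?thesis
    proof (induction rule: sigma_sets_induct_disjoint)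
      case (compl A)
      then have "A \<in> sets lebesgue" using sub by blast
      moreover have "(UNIV - A) \<inter> A = {}" "(UNIV - A) \<union> A = UNIV" by auto
      ultimately have "(LINT x:(UNIV - A)|lebesgue. f x) + (LINT x:A|lebesgue. f x) = (\<integral>x. f x \<partial>lebesgue)"
        using set_integral_Un[of "UNIV - A" A lebesgue f] si sets.compl_sets[of A lebesgue]
        by (simp add: set_lebesgue_integral_def)
      then show ?case using compl total by simp
    next
      case (union A)
      then have "A i \<in> sets lebesgue" for i using sub by blast
      then show ?case
        using lebesgue_integral_countable_add[of A lebesgue f] union si
        by (auto simp: disjoint_family_on_def)
    qed (use box in \<open>auto simp: set_lebesgue_integral_def\<close>)
  qed
  fix A :: "'a set" assume A: "A \<in> sets lebesgue"
  \<comment> \<open>A Lebesgue set is a Borel set together with part of a null set, which the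
    integral does not see.\<close>
  have "(LINT x:A|lebesgue. f x) = (LINT x:main_part lborel A|lebesgue. f x)"
    unfolding set_lebesgue_integral_def
  proof (rule integral_cong_AE)
    have "AE x in lebesgue. x \<notin> null_part lborel A"
      using AE_notin_null_part[OF A] by (rule AE_completion)
    then show "AE x in lebesgue. indicator A x *\<^sub>R f x = indicator (main_part lborel A) x *\<^sub>R f x"
    proof eventually_elim
      case (elim x)
      then have "x \<in> A \<longleftrightarrow> x \<in> main_part lborel A"
        using main_part_null_part_Un[OF A] by blast
      then show ?case by (simp add: indicator_def)
    qed
  qed (use A f main_part_sets[OF A] in \<open>auto intro!: borel_measurable_times borel_measurable_indicator\<close>)
  then show "(LINT x:A|lebesgue. f x) = (LINT x:A|lebesgue. 0)"
    using borel main_part_sets[OF A] by (simp add: set_lebesgue_integral_def)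
qed

text \<open>An open set is a countable union of closed boxes, so it suffices to treat one of them;
  there \<open>w\<close>, cut off to the open box, is integrable over the whole space.\<close>

lemma locally_integrable_AE_eq_0:
  fixes w :: "real ^ 'n \<Rightarrow> real"
  assumes \<Omega>: "open \<Omega>" and w: "locally_integrable \<Omega> w"
    and test: "\<And>\<phi>. test_function \<Omega> \<phi> \<Longrightarrow> (LINT x:\<Omega>|lebesgue. w x * \<phi> x) = 0"
  shows "AE x in lebesgue. x \<in> \<Omega> \<longrightarrow> w x = 0"
proof -
  have on_cbox: "AE x in lebesgue. x \<in> cbox a b \<longrightarrow> w x = 0" if ab: "cbox a b \<subseteq> \<Omega>" for a b
  proof -
    define f where "f x = indicator (box a b) x * w x" for x
    have "set_integrable lebesgue (cbox a b) w"
      using w ab by (simp add: locally_integrable_def)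
    then have "set_integrable lebesgue (box a b) w"
      by (rule set_integrable_subset) (simp_all add: box_subset_cbox)
    then have "integrable lebesgue f"
      by (simp add: set_integrable_def f_def[abs_def])
    moreover have "(\<integral>x. f x \<partial>lebesgue) = 0"
      using set_integral_box_eq_0[OF w ab test] by (simp add: set_lebesgue_integral_def f_def)
    moreover have "(LINT x:box l u|lebesgue. f x) = 0" for l u
    proof -
      obtain c d where cd: "box a b \<inter> box l u = box c d"
        unfolding box_Int_box by blast
      have "(LINT x:box c d|lebesgue. w x) = 0"
      \<comment> \<open>For a nonempty open box, \<open>cbox c d\<close> is its closure and so stays
        inside \<open>cbox a b\<close>. An empty one may come with a nonempty degenerate
        \<open>cbox c d\<close> of unknown position.\<close>
      proof (cases "box c d = {}")
        case False
        have "box c d \<subseteq> cbox a b"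
          using cd box_subset_cbox[of a b] by blast
        then have "cbox c d \<subseteq> cbox a b"
          unfolding closure_box[OF False, symmetric] by (rule closure_minimal[OF _ closed_cbox])
        then show ?thesis
          using ab by (intro set_integral_box_eq_0[OF w _ test]) auto
      qed (simp add: set_lebesgue_integral_def)
      moreover have "indicator (box l u) x *\<^sub>R f x = indicator (box c d) x *\<^sub>R w x" for x
        by (auto simp: f_def simp flip: cd split: split_indicator)
      ultimately show ?thesis
        by (simp add: set_lebesgue_integral_def)
    qed
    ultimately have "AE x in lebesgue. f x = 0"
      by (rule AE_eq_0_if_box_integrals_eq_0)
    \<comment> \<open>The faces of the box form a null set, so vanishing on the open box is
      enough.\<close>
    moreover have "AE x in lebesgue. x \<notin> cbox a b - box a b"
      using negligible_frontier_interval by (intro AE_not_in) (simp add: negligible_iff_null_sets)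
    ultimately show ?thesis
    proof eventually_elim
      case (elim x)
      then show ?case by (cases "x \<in> box a b") (simp_all add: f_def)
    qed
  qed
  obtain \<D> where \<D>: "countable \<D>" "\<D> \<subseteq> Pow \<Omega>" "\<And>X. X \<in> \<D> \<Longrightarrow> \<exists>a b. X = cbox a b" "\<Union>\<D> = \<Omega>"
    using open_countable_Union_open_cbox[OF \<Omega>] by metis
  have "AE x in lebesgue. \<forall>X\<in>\<D>. x \<in> X \<longrightarrow> w x = 0"
    unfolding AE_ball_countable[OF \<D>(1)]
  proof
    fix X assume "X \<in> \<D>"
    then obtain a b where "X = cbox a b" "cbox a b \<subseteq> \<Omega>"
      using \<D>(2,3) by (metis PowD subsetD)
    then show "AE x in lebesgue. x \<in> X \<longrightarrow> w x = 0"
      using on_cbox by simp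
  qed
  then show ?thesis
    by (rule AE_mp) (use \<D>(4) in auto)
qed

section \<open>Weak derivatives of ridge functions\<close>

text \<open>Off its support \<open>\<phi>\<close> vanishes on an open set, and so does its
  derivative; on the compact support the continuous derivative is bounded.\<close>

lemma C1_compact_support_derivative:
  fixes \<phi> :: "real ^ 'n \<Rightarrow> real"
  assumes "Ck 1 \<phi>" and K: "compact (closure {x. \<phi> x \<noteq> 0})"
  shows "(\<phi> has_derivative frechet_derivative \<phi> (at x)) (at x)"
    and "continuous_on UNIV (\<lambda>x. frechet_derivative \<phi> (at x) \<eta>)"
    and "x \<notin> closure {x. \<phi> x \<noteq> 0} \<Longrightarrow> frechet_derivative \<phi> (at x) \<eta> = 0"
    and "\<exists>B\<ge>0. \<forall>x. \<bar>frechet_derivative \<phi> (at x) \<eta>\<bar> \<le> B"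
proof -
  define S where "S = closure {x. \<phi> x \<noteq> 0}"
  show D: "(\<phi> has_derivative frechet_derivative \<phi> (at x)) (at x)" for x
    using assms(1) by (simp add: frechet_derivative_works)
  show cont: "continuous_on UNIV (\<lambda>x. frechet_derivative \<phi> (at x) \<eta>)"
    using assms(1) by simp
  show zero: "frechet_derivative \<phi> (at x) \<eta> = 0" if "x \<notin> closure {x. \<phi> x \<noteq> 0}" for x
  proof -
    have "(\<phi> has_derivative (\<lambda>_. 0)) (at x)"
      by (rule has_derivative_transform_within_open[of "\<lambda>_. 0" _ x UNIV "- closure {x. \<phi> x \<noteq> 0}"])
        (use that closure_subset[of "{x. \<phi> x \<noteq> 0}"] in auto)
    then show ?thesis
      using frechet_derivative_at by metis
  qed
  have "compact ((\<lambda>x. frechet_derivative \<phi> (at x) \<eta>) ` S)"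
    unfolding S_def by (rule compact_continuous_image[OF continuous_on_subset[OF cont subset_UNIV] K])
  then obtain B where "B > 0" "\<forall>x\<in>S. \<bar>frechet_derivative \<phi> (at x) \<eta>\<bar> \<le> B"
    by (auto dest!: compact_imp_bounded simp: bounded_pos)
  then show "\<exists>B\<ge>0. \<forall>x. \<bar>frechet_derivative \<phi> (at x) \<eta>\<bar> \<le> B"
    using zero unfolding S_def by (metis abs_zero less_imp_le)
qed

lemma integral_lborel_translate:
  fixes f :: "'a::euclidean_space \<Rightarrow> real"
  assumes "f \<in> borel_measurable borel"
  shows "(\<integral>x. f (c + x) \<partial>lborel) = (\<integral>x. f x \<partial>lborel)"
proof -
  have "(\<integral>x. f x \<partial>distr lborel borel ((+) c)) = (\<integral>x. f (c + x) \<partial>lborel)"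
    using assms by (intro integral_distr) auto
  then show ?thesis by (simp add: lborel_distr_plus)
qed

lemma integrable_lborel_bounded_support:
  fixes f :: "'a::euclidean_space \<Rightarrow> real"
  assumes "f \<in> borel_measurable lborel" "\<And>x. \<bar>f x\<bar> \<le> B" "\<And>x. x \<notin> cball 0 R \<Longrightarrow> f x = 0"
  shows "integrable lborel f"
proof (rule Bochner_Integration.integrable_bound)
  show "integrable lborel (\<lambda>x. B * indicator (cball 0 R) (x :: 'a) :: real)"
    using emeasure_lborel_cball_finite[of "0::'a" R] by (intro integrable_mult_right integrable_real_indicator) auto
  show "AE x in lborel. norm (f x) \<le> norm (B * indicator (cball 0 R) x)"
    using assms(2,3) by (intro AE_I2) (fastforce simp: indicator_def intro: order_trans[OF _ abs_ge_self])
qed (use assms in simp)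

text \<open>All difference quotients fall on \<open>\<phi>\<close>, so \<open>g\<close> may have
  jumps. Translation invariance makes their integrals vanish, and dominated convergence passes to
  the derivative.\<close>

lemma integral_ridge_times_tangential_derivative:
  fixes \<phi> :: "real ^ 'n \<Rightarrow> real" and g :: "real \<Rightarrow> real"
  assumes \<phi>: "Ck 1 \<phi>" and K: "compact (closure {x. \<phi> x \<noteq> 0})"
    and g[measurable]: "g \<in> borel_measurable borel" and M: "\<And>t. \<bar>g t\<bar> \<le> M"
    and \<eta>: "\<eta> \<bullet> \<xi> = 0"
  shows "(\<integral>x. g (\<xi> \<bullet> x) * frechet_derivative \<phi> (at x) \<eta> \<partial>lborel) = 0"
proof -
  note C1 = C1_compact_support_derivative[OF \<phi> K]
  let ?d = "\<lambda>x. frechet_derivative \<phi> (at x) \<eta>"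
  obtain B where B: "B \<ge> 0" "\<And>x. \<bar>?d x\<bar> \<le> B"
    using C1(4) by blast
  have cont: "continuous_on UNIV \<phi>"
    by (rule has_derivative_continuous_on[OF has_derivative_at_withinI[OF C1(1)]])
  have [measurable]: "\<phi> \<in> borel_measurable borel" "?d \<in> borel_measurable borel"
    by (rule borel_measurable_continuous_onI[OF cont], rule borel_measurable_continuous_onI[OF C1(2)])
  obtain R where R: "\<And>x. \<phi> x \<noteq> 0 \<Longrightarrow> norm x \<le> R"
    using compact_imp_bounded[OF K] closure_subset[of "{x. \<phi> x \<noteq> 0}"]
    unfolding bounded_iff by blast
  have "compact (\<phi> ` closure {x. \<phi> x \<noteq> 0})"
    by (rule compact_continuous_image[OF continuous_on_subset[OF cont subset_UNIV] K])
  then obtain C where C': "0 < C" "\<forall>x\<in>closure {x. \<phi> x \<noteq> 0}. \<bar>\<phi> x\<bar> \<le> C"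
    by (auto dest!: compact_imp_bounded simp: bounded_pos)
  have C: "\<bar>\<phi> x\<bar> \<le> C" for x
    using C' closure_subset[of "{x. \<phi> x \<noteq> 0}"] by (cases "\<phi> x = 0") auto
  have M0: "0 \<le> M" using M[of 0] by linarith
  \<comment> \<open>Steps of length at most 1 keep the supports of all difference quotients in the
    ball of radius \<open>R + norm \<eta>\<close>, on which the majorant lives.\<close>
  define h where "h m = 1 / real (Suc m)" for m
  have h: "0 < h m" "h m \<le> 1" for m by (auto simp: h_def)
  define q where "q m x = g (\<xi> \<bullet> x) * ((\<phi> (h m *\<^sub>R \<eta> + x) - \<phi> x) / h m)" for m x
  have [measurable]: "q m \<in> borel_measurable borel" for m
    unfolding q_def by measurable
  have der: "((\<lambda>t. \<phi> (t *\<^sub>R \<eta> + x)) has_real_derivative ?d (t *\<^sub>R \<eta> + x)) (at t)" for x t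
  proof -
    have "((\<lambda>t. \<phi> (t *\<^sub>R \<eta> + x)) has_derivative (\<lambda>s. frechet_derivative \<phi> (at (t *\<^sub>R \<eta> + x)) (s *\<^sub>R \<eta>))) (at t)"
      by (rule has_derivative_compose[OF _ C1(1)]) (auto intro!: derivative_eq_intros)
    then show ?thesis
      using linear_cmul[OF has_derivative_linear[OF C1(1)]]
      by (simp add: has_field_derivative_def mult_commute_abs)
  qed
  \<comment> \<open>The mean value theorem bounds the quotients by the bound \<open>B\<close> of the
    derivative, uniformly in \<open>m\<close> and \<open>x\<close>.\<close>
  have lip: "\<bar>(\<phi> (h m *\<^sub>R \<eta> + x) - \<phi> x) / h m\<bar> \<le> B" for m x
  proof -
    obtain z where "\<phi> (h m *\<^sub>R \<eta> + x) - \<phi> (0 *\<^sub>R \<eta> + x) = (h m - 0) * ?d (z *\<^sub>R \<eta> + x)"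
      using MVT2[OF h(1)[of m], of "\<lambda>t. \<phi> (t *\<^sub>R \<eta> + x)", OF der] by blast
    then show ?thesis
      using B(2) h(1)[of m] by simp
  qed
  have "(\<lambda>m. \<integral>x. q m x \<partial>lborel) \<longlonglongrightarrow> (\<integral>x. g (\<xi> \<bullet> x) * ?d x \<partial>lborel)"
  proof (rule integral_dominated_convergence)
    show "integrable lborel (\<lambda>x. M * B * indicator (cball (0::real ^ 'n) (R + norm \<eta>)) x :: real)"
      using emeasure_lborel_cball_finite[of "0::real ^ 'n" "R + norm \<eta>"] by (intro integrable_mult_right integrable_real_indicator) auto
    show "AE x in lborel. norm (q m x) \<le> M * B * indicator (cball (0::real ^ 'n) (R + norm \<eta>)) x" for m
    proof (rule AE_I2)
      fix x
      show "norm (q m x) \<le> M * B * indicator (cball 0 (R + norm \<eta>)) x"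
      proof (cases "norm x \<le> R + norm \<eta>")
        case True
        then show ?thesis
          using mult_mono[OF M[of "\<xi> \<bullet> x"] lip[of m x]] M0 by (simp add: q_def abs_mult)
      next
        case False
        have "norm x \<le> norm (h m *\<^sub>R \<eta> + x) + norm (h m *\<^sub>R \<eta>)"
          using norm_triangle_ineq4[of "h m *\<^sub>R \<eta> + x" "h m *\<^sub>R \<eta>"] by simp
        moreover have "norm (h m *\<^sub>R \<eta>) \<le> norm \<eta>"
          using h[of m] by (simp add: mult_left_le_one_le)
        ultimately have "\<phi> (h m *\<^sub>R \<eta> + x) = 0"
          using R[of "h m *\<^sub>R \<eta> + x"] False by linarith
        moreover have "\<phi> x = 0" using R[of x] False norm_ge_zero[of \<eta>] by linarith
        ultimately show ?thesis using False by (simp add: q_def)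
      qed
    qed
    show "AE x in lborel. (\<lambda>m. q m x) \<longlonglongrightarrow> g (\<xi> \<bullet> x) * ?d x"
    proof (rule AE_I2)
      fix x
      have "((\<lambda>t. (\<phi> (t *\<^sub>R \<eta> + x) - \<phi> x) / t) \<longlongrightarrow> ?d x) (at 0)"
        using der[of x 0] by (simp add: DERIV_def)
      moreover have "filterlim h (at 0) sequentially"
        unfolding filterlim_at h_def using LIMSEQ_inverse_real_of_nat by (simp add: inverse_eq_divide)
      ultimately have "(\<lambda>m. (\<phi> (h m *\<^sub>R \<eta> + x) - \<phi> x) / h m) \<longlonglongrightarrow> ?d x"
        by (rule filterlim_compose)
      then show "(\<lambda>m. q m x) \<longlonglongrightarrow> g (\<xi> \<bullet> x) * ?d x"
        unfolding q_def by (intro tendsto_intros)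
    qed
  qed (measurable, measurable)
  moreover have "(\<integral>x. q m x \<partial>lborel) = 0" for m
  proof -
    define G where "G x = g (\<xi> \<bullet> x) * \<phi> x" for x
    have [measurable]: "G \<in> borel_measurable borel" unfolding G_def by measurable
    have "\<bar>G x\<bar> \<le> M * C" for x
      using mult_mono[OF M[of "\<xi> \<bullet> x"] C[of x]] M0 by (simp add: G_def abs_mult)
    then have int: "integrable lborel G"
      by (rule integrable_lborel_bounded_support[rotated, where R = R]) (use R in \<open>auto simp: G_def\<close>)
    have int': "integrable lborel (\<lambda>x. G (h m *\<^sub>R \<eta> + x))"
      using int integrable_distr_eq[of "(+) (h m *\<^sub>R \<eta>)" lborel borel G]
      by (simp add: lborel_distr_plus)
    \<comment> \<open>Moving by a multiple of \<open>\<eta>\<close> does not change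
      \<open>\<xi> \<bullet> x\<close>, so \<open>q m\<close> is a difference quotient of the
      integrable function \<open>G\<close>, whose two terms have equal integrals.\<close>
    have "q m x = (G (h m *\<^sub>R \<eta> + x) - G x) / h m" for x
      using \<eta> by (simp add: q_def G_def inner_add_right inner_commute algebra_simps diff_divide_distrib)
    then have "(\<integral>x. q m x \<partial>lborel) = ((\<integral>x. G (h m *\<^sub>R \<eta> + x) \<partial>lborel) - (\<integral>x. G x \<partial>lborel)) / h m"
      using int int' by simp
    then show ?thesis by (simp add: integral_lborel_translate)
  qed
  ultimately show ?thesis
    by (simp add: LIMSEQ_const_iff)
qed

text \<open>Carries Borel computations over to the completed measure: completeness makes
  \<open>f\<close> measurable although it is prescribed only up to a null set.\<close>

lemma integral_lebesgue_cong_AE_borel: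
  fixes f g :: "'a::euclidean_space \<Rightarrow> real"
  assumes g: "g \<in> borel_measurable borel" and ae: "AE x in lebesgue. f x = g x"
  shows "f \<in> borel_measurable lebesgue"
    and "(\<integral>x. f x \<partial>lebesgue) = (\<integral>x. g x \<partial>lborel)"
    and "integrable lborel g \<Longrightarrow> integrable lebesgue f"
proof -
  have g': "g \<in> borel_measurable lebesgue"
    using g by (intro measurable_completion) simp
  have "AE x in lebesgue. g x = f x"
    using ae by eventually_elim simp
  then show f: "f \<in> borel_measurable lebesgue"
    using g' by (rule borel_measurable_AE[rotated])
  show "(\<integral>x. f x \<partial>lebesgue) = (\<integral>x. g x \<partial>lborel)"
    using integral_cong_AE[OF f g' ae] g by (simp add: integral_completion)
  show "integrable lebesgue f" if "integrable lborel g"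
    using integrable_cong_AE[OF f g' ae] that g by (simp add: integrable_completion)
qed

text \<open>Cut off to the bounded set \<open>A\<close>, the ridge function is bounded with support
  in a ball, hence integrable, and changes on a null set are harmless.\<close>

lemma ridge_integrable_on:
  fixes v :: "real ^ 'n \<Rightarrow> real"
  assumes A: "A \<in> sets borel" "bounded A"
    and g[measurable]: "g \<in> borel_measurable borel" and M: "\<And>t. \<bar>g t\<bar> \<le> M"
    and ae: "AE x in lebesgue. x \<in> A \<longrightarrow> v x = g (\<xi> \<bullet> x)"
  shows "set_borel_measurable lebesgue A v" and "set_integrable lebesgue A v"
proof -
  note [measurable] = A(1)
  let ?g = "\<lambda>x. indicator A x *\<^sub>R g (\<xi> \<bullet> x)"
  have ae': "AE x in lebesgue. indicator A x *\<^sub>R v x = ?g x"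
    using ae by eventually_elim (simp add: indicator_def)
  obtain R where R: "\<forall>x\<in>A. norm x \<le> R"
    using A(2) by (auto simp: bounded_iff)
  have g_meas: "?g \<in> borel_measurable borel"
    by measurable
  have "integrable lborel ?g"
  proof (rule integrable_lborel_bounded_support)
    show "?g \<in> borel_measurable lborel"
      using g_meas by simp
    show "\<bar>?g x\<bar> \<le> M" for x
      using M[of "\<xi> \<bullet> x"] by (auto split: split_indicator)
    show "?g x = 0" if "x \<notin> cball 0 R" for x
      using R that by (auto split: split_indicator)
  qed
  then show "set_integrable lebesgue A v"
    unfolding set_integrable_def by (rule integral_lebesgue_cong_AE_borel(3)[OF g_meas ae'])
  show "set_borel_measurable lebesgue A v"
    unfolding set_borel_measurable_def by (rule integral_lebesgue_cong_AE_borel(1)[OF g_meas ae'])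
qed

lemma ridge_has_weak_directional_derivative:
  fixes v :: "real ^ 'n \<Rightarrow> real"
  assumes g[measurable]: "g \<in> borel_measurable borel" and M: "\<And>t. \<bar>g t\<bar> \<le> M"
    and ae: "AE x in lebesgue. x \<in> \<Omega> \<longrightarrow> v x = g (\<xi> \<bullet> x)"
    and \<eta>: "\<eta> \<bullet> \<xi> = 0"
  shows "has_weak_directional_derivative \<Omega> \<eta> v (\<lambda>_. 0)"
  unfolding has_weak_directional_derivative_def
proof (intro conjI allI impI)
  show "locally_integrable \<Omega> v"
    unfolding locally_integrable_def
  proof (intro allI impI)
    fix K assume K: "compact K \<and> K \<subseteq> \<Omega>"
    then have "AE x in lebesgue. x \<in> K \<longrightarrow> v x = g (\<xi> \<bullet> x)"
      using ae by eventually_elim (use K in blast)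
    then show "set_integrable lebesgue K v"
      using K M by (intro ridge_integrable_on[of K g M v \<xi>]) (auto simp: compact_imp_bounded borel_compact)
  qed
  show "locally_integrable \<Omega> (\<lambda>_. 0)"
    by (simp add: locally_integrable_def set_integrable_def)
  fix \<phi> assume "test_function \<Omega> \<phi>"
  then have \<phi>: "Ck 1 \<phi>" "compact (closure {x. \<phi> x \<noteq> 0})" "closure {x. \<phi> x \<noteq> 0} \<subseteq> \<Omega>"
    unfolding test_function_def by auto
  let ?d = "\<lambda>x. frechet_derivative \<phi> (at x) \<eta>"
  have [measurable]: "?d \<in> borel_measurable borel"
    using C1_compact_support_derivative(2)[OF \<phi>(1,2)] by (intro borel_measurable_continuous_onI)
  \<comment> \<open>The support of \<open>\<phi>\<close> lies in \<open>\<Omega>\<close>, so its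
    derivative vanishes outside and the integral over \<open>\<Omega>\<close> extends to the whole
    space.\<close>
  have ae': "AE x in lebesgue. indicator \<Omega> x *\<^sub>R (v x * ?d x) = g (\<xi> \<bullet> x) * ?d x"
    using ae
  proof eventually_elim
    case (elim x)
    then show ?case
      using C1_compact_support_derivative(3)[OF \<phi>(1,2), of x \<eta>] \<phi>(3) by (cases "x \<in> \<Omega>") auto
  qed
  have "(\<lambda>x. g (\<xi> \<bullet> x) * ?d x) \<in> borel_measurable borel"
    by measurable
  then have "(LINT x:\<Omega>|lebesgue. v x * ?d x) = (\<integral>x. g (\<xi> \<bullet> x) * ?d x \<partial>lborel)"
    unfolding set_lebesgue_integral_def by (rule integral_lebesgue_cong_AE_borel(2)[OF _ ae'])
  also have "\<dots> = 0"
    by (rule integral_ridge_times_tangential_derivative[OF \<phi>(1,2) g M \<eta>])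
  finally show "(LINT x:\<Omega>|lebesgue. v x * ?d x) = - (LINT x:\<Omega>|lebesgue. 0 * \<phi> x)"
    by (simp add: set_lebesgue_integral_def)
qed

text \<open>Both weak derivatives are tested against the same integral of \<open>v\<close>, which
  the zero derivative forces to be 0; the fundamental lemma then applies to
  \<open>w\<close>.\<close>

lemma zero_weak_directional_derivative_unique:
  fixes v :: "real ^ 'n \<Rightarrow> real"
  assumes \<Omega>: "open \<Omega>" and zero: "has_weak_directional_derivative \<Omega> \<eta> v (\<lambda>_. 0)"
    and w: "has_weak_directional_derivative \<Omega> \<eta> v w"
  shows "AE x in lebesgue. x \<in> \<Omega> \<longrightarrow> w x = 0"
proof (rule locally_integrable_AE_eq_0[OF \<Omega>])
  show "locally_integrable \<Omega> w"
    using w by (simp add: has_weak_directional_derivative_def)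
  fix \<phi> assume "test_function \<Omega> \<phi>"
  then show "(LINT x:\<Omega>|lebesgue. w x * \<phi> x) = 0"
    using zero w by (simp add: has_weak_directional_derivative_def set_lebesgue_integral_def)
qed

section \<open>Integrals of ridge functions over bounded sets\<close>

lemma nn_integral_lborel_translate:
  fixes f :: "'a::euclidean_space \<Rightarrow> ennreal"
  assumes "f \<in> borel_measurable borel"
  shows "(\<integral>\<^sup>+x. f (c + x) \<partial>lborel) = (\<integral>\<^sup>+x. f x \<partial>lborel)"
proof -
  have "(\<integral>\<^sup>+x. f x \<partial>distr lborel borel ((+) c)) = (\<integral>\<^sup>+x. f (c + x) \<partial>lborel)"
    using assms by (intro nn_integral_distr) auto
  then show ?thesis by (simp add: lborel_distr_plus)
qed

text \<open>With \<open>B\<close> the unit ball, \<open>\<integral>\<integral> 1\<^sub>B(y) g(y + T x) dx dy\<close> equals \<open>\<bar>B\<bar> \<integral> g \<circ> T\<close> by translating \<open>x\<close> and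
  \<open>\<bar>B\<bar> \<integral> g\<close> by translating \<open>y\<close>, since \<open>T\<close> preserves \<open>B\<close>. The library's \<open>measure_orthogonal_image\<close> is not
  applicable because it needs a well-ordered index type.\<close>

lemma nn_integral_lborel_orthogonal:
  fixes T :: "'a::euclidean_space \<Rightarrow> 'a" and g :: "'a \<Rightarrow> ennreal"
  assumes T: "orthogonal_transformation T" and [measurable]: "g \<in> borel_measurable borel"
  shows "(\<integral>\<^sup>+x. g (T x) \<partial>lborel) = (\<integral>\<^sup>+x. g x \<partial>lborel)"
proof -
  define B :: "'a \<Rightarrow> ennreal" where "B = indicator (ball 0 1)"
  have [measurable]: "B \<in> borel_measurable borel"
    unfolding B_def by (intro borel_measurable_indicator) simp
  have lin: "linear T" using T by (rule orthogonal_transformation_linear)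
  then have [measurable]: "T \<in> borel_measurable borel"
    by (intro borel_measurable_continuous_onI linear_continuous_on linear_conv_bounded_linear[THEN iffD1])
  \<comment> \<open>With the right inverse \<open>S\<close>, a shift of \<open>x\<close> by
    \<open>S y\<close> becomes a shift of \<open>T x\<close> by \<open>y\<close>.\<close>
  obtain S where S: "T (S y) = y" for y
    using orthogonal_transformation_surj[OF T] by (metis surjD)
  have B_shift: "(\<integral>\<^sup>+x. B (y - T x) \<partial>lborel) = (\<integral>\<^sup>+x. B x \<partial>lborel)" for y
  proof -
    have "norm (y - T (S y + x)) = norm x" for x
      using orthogonal_transformation_norm[OF T, of x] by (simp add: linear_add[OF lin] S)
    then have "B (y - T (S y + x)) = B x" for x
      by (simp add: B_def indicator_def)
    then show ?thesis
      using nn_integral_lborel_translate[of "\<lambda>x. B (y - T x)" "S y"] by simp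
  qed
  \<comment> \<open>The volume of the ball must be neither 0 nor infinite for the final cancellation
    in \<open>ennreal\<close>.\<close>
  have "emeasure lborel (ball 0 1 :: 'a set) \<noteq> 0"
    using open_not_negligible[of "ball 0 1 :: 'a set"]
    by (auto simp: negligible_iff_null_sets null_sets_def)
  then have B_fin: "(\<integral>\<^sup>+x. B x \<partial>lborel) \<noteq> 0" "(\<integral>\<^sup>+x. B x \<partial>lborel) \<noteq> \<infinity>"
    using emeasure_lborel_ball_finite[of "0::'a" 1] by (auto simp: B_def)
  have "(\<integral>\<^sup>+x. B x \<partial>lborel) * (\<integral>\<^sup>+x. g (T x) \<partial>lborel)
      = (\<integral>\<^sup>+y. \<integral>\<^sup>+x. B y * g (T x) \<partial>lborel \<partial>lborel)"
    by (simp add: nn_integral_cmult nn_integral_multc)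
  also have "\<dots> = (\<integral>\<^sup>+y. \<integral>\<^sup>+x. B y * g (y + T x) \<partial>lborel \<partial>lborel)"
  proof (rule nn_integral_cong)
    fix y
    show "(\<integral>\<^sup>+x. B y * g (T x) \<partial>lborel) = (\<integral>\<^sup>+x. B y * g (y + T x) \<partial>lborel)"
      using nn_integral_lborel_translate[of "\<lambda>x. B y * g (T x)" "S y"]
      by (simp add: linear_add[OF lin] S)
  qed
  also have "\<dots> = (\<integral>\<^sup>+x. \<integral>\<^sup>+y. B y * g (y + T x) \<partial>lborel \<partial>lborel)"
    by (rule lborel_pair.Fubini') measurable
  also have "\<dots> = (\<integral>\<^sup>+x. \<integral>\<^sup>+y. B (y - T x) * g y \<partial>lborel \<partial>lborel)"
  proof (rule nn_integral_cong)
    fix x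
    show "(\<integral>\<^sup>+y. B y * g (y + T x) \<partial>lborel) = (\<integral>\<^sup>+y. B (y - T x) * g y \<partial>lborel)"
      using nn_integral_lborel_translate[of "\<lambda>y. B (y - T x) * g y" "T x"]
      by (simp add: add.commute)
  qed
  also have "\<dots> = (\<integral>\<^sup>+y. \<integral>\<^sup>+x. B (y - T x) * g y \<partial>lborel \<partial>lborel)"
    by (rule lborel_pair.Fubini') measurable
  also have "\<dots> = (\<integral>\<^sup>+x. B x \<partial>lborel) * (\<integral>\<^sup>+y. g y \<partial>lborel)"
    by (simp add: nn_integral_multc nn_integral_cmult B_shift)
  finally show ?thesis
    using B_fin by (simp add: ennreal_mult_cancel_left)
qed

text \<open>An orthogonal map \<open>T\<close> takes a coordinate axis \<open>e\<close> to
  \<open>u\<close>, and the preimage \<open>V\<close> of \<open>\<Omega>\<close> keeps its diameter.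
  The integrand is dominated by a product of functions of single coordinates: \<open>F\<close> along
  \<open>e\<close> and an interval of length \<open>diameter \<Omega>\<close> along each other
  axis.\<close>

lemma nn_integral_slice_le:
  fixes \<Omega> :: "(real ^ 'n) set" and F :: "real \<Rightarrow> ennreal"
  assumes \<Omega>: "\<Omega> \<in> sets borel" "bounded \<Omega>" and F[measurable]: "F \<in> borel_measurable borel"
    and u: "norm u = 1"
  shows "(\<integral>\<^sup>+x. indicator \<Omega> x * F (u \<bullet> x) \<partial>lborel)
    \<le> ennreal (diameter \<Omega>) ^ (CARD('n) - 1) * (\<integral>\<^sup>+s. F s \<partial>lborel)"
proof (cases "\<Omega> = {}")
  case False
  note [measurable] = \<Omega>(1)
  fix k :: 'n
  define e :: "real ^ 'n" where "e = axis k 1"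
  have e: "e \<in> Basis" "norm e = 1" by (auto simp: e_def axis_in_Basis_iff)
  obtain T where T: "orthogonal_transformation T" "T e = u"
    using orthogonal_transformation_exists_1[OF e(2) u] by blast
  define V where "V = {x. T x \<in> \<Omega>}"
  obtain y0 where y0: "y0 \<in> V"
    using False orthogonal_transformation_surj[OF T(1)] unfolding V_def by (metis all_not_in_conv mem_Collect_eq surjD)
  have V_diam: "\<bar>x \<bullet> b - y \<bullet> b\<bar> \<le> diameter \<Omega>" if "x \<in> V" "y \<in> V" "b \<in> Basis" for x y b
  proof -
    have "\<bar>x \<bullet> b - y \<bullet> b\<bar> \<le> norm (x - y)"
      using Basis_le_norm[OF that(3), of "x - y"] by (simp add: inner_diff_left)
    also have "\<dots> = norm (T x - T y)"
      using T(1) by (metis linear_diff orthogonal_transformation_linear orthogonal_transformation_norm)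
    also have "\<dots> \<le> diameter \<Omega>"
      using diameter_bounded_bound[OF \<Omega>(2)] that by (simp add: V_def dist_norm)
    finally show ?thesis .
  qed
  \<comment> \<open>Starting each interval at the infimum of the coordinate over \<open>V\<close>
    lets length \<open>diameter \<Omega>\<close> suffice.\<close>
  define l where "l b = (INF y\<in>V. y \<bullet> b)" for b
  have l: "x \<bullet> b \<in> {l b..l b + diameter \<Omega>}" if x: "x \<in> V" and b: "b \<in> Basis" for x b
  proof -
    have "bdd_below ((\<lambda>y. y \<bullet> b) ` V)"
      by (rule bdd_belowI2[where m = "x \<bullet> b - diameter \<Omega>"]) (use V_diam[OF x _ b] in force)
    then have "l b \<le> x \<bullet> b"
      unfolding l_def using x by (rule cINF_lower)
    moreover have "x \<bullet> b - diameter \<Omega> \<le> l b"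
      unfolding l_def by (rule cINF_greatest) (use V_diam[OF x _ b] y0 in force)+
    ultimately show ?thesis by simp
  qed
  define f where "f b = (if b = e then F else indicator {l b..l b + diameter \<Omega>})" for b
  have "(\<integral>\<^sup>+x. indicator \<Omega> x * F (u \<bullet> x) \<partial>lborel) = (\<integral>\<^sup>+x. indicator \<Omega> (T x) * F (u \<bullet> T x) \<partial>lborel)"
    by (rule nn_integral_lborel_orthogonal[OF T(1), symmetric]) measurable
  also have "\<dots> \<le> (\<integral>\<^sup>+x. (\<Prod>b\<in>Basis. f b (x \<bullet> b)) \<partial>lborel)"
  proof (rule nn_integral_mono)
    fix x
    have "u \<bullet> T x = x \<bullet> e"
      using T by (metis inner_commute orthogonal_transformation_def)
    moreover have "indicator \<Omega> (T x) \<le> (\<Prod>b\<in>Basis - {e}. f b (x \<bullet> b))"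
    proof (cases "x \<in> V")
      case True
      then have "(\<Prod>b\<in>Basis - {e}. f b (x \<bullet> b)) = 1"
        by (intro prod.neutral) (use l in \<open>auto simp: f_def\<close>)
      then show ?thesis by (simp add: indicator_def)
    qed (simp add: V_def)
    ultimately show "indicator \<Omega> (T x) * F (u \<bullet> T x) \<le> (\<Prod>b\<in>Basis. f b (x \<bullet> b))"
      using e(1) by (subst prod.remove[of _ e]) (auto simp: f_def mult.commute intro!: mult_left_mono)
  qed
  also have "\<dots> = (\<Prod>b\<in>Basis. \<integral>\<^sup>+s. f b s \<partial>lborel)"
    by (rule nn_integral_lborel_prod) (auto simp: f_def)
  also have "\<dots> = (\<integral>\<^sup>+s. F s \<partial>lborel) * (\<Prod>b\<in>Basis - {e}. \<integral>\<^sup>+s. f b s \<partial>lborel)"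
    using e(1) by (subst prod.remove[of _ e]) (auto simp: f_def)
  also have "(\<Prod>b\<in>Basis - {e}. \<integral>\<^sup>+s. f b s \<partial>lborel) = (\<Prod>b\<in>(Basis :: (real ^ 'n) set) - {e}. ennreal (diameter \<Omega>))"
    by (rule prod.cong) (auto simp: f_def diameter_ge_0[OF \<Omega>(2)])
  also have "\<dots> = ennreal (diameter \<Omega>) ^ (CARD('n) - 1)"
    using e(1) by (simp add: card_Diff_singleton)
  finally show ?thesis
    by (simp add: mult.commute)
qed simp

text \<open>Each half of the hat contributes \<open>\<epsilon> / 3\<close>, by a cubic
  antiderivative. The two closed intervals share the point 0, so the pointwise comparison is only an
  inequality.\<close>

lemma hat_square_integral_le:
  fixes \<epsilon> :: real
  assumes "\<epsilon> > 0"
  shows "(\<integral>\<^sup>+t. ennreal ((max 0 (1 - \<bar>t\<bar> / \<epsilon>))\<^sup>2) \<partial>lborel) \<le> ennreal (2 * \<epsilon> / 3)"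
proof -
  have "(\<integral>\<^sup>+t. ennreal ((max 0 (1 - \<bar>t\<bar> / \<epsilon>))\<^sup>2) \<partial>lborel)
     \<le> (\<integral>\<^sup>+t. ennreal ((1 - t / \<epsilon>)\<^sup>2) * indicator {0..\<epsilon>} t
           + ennreal ((1 + t / \<epsilon>)\<^sup>2) * indicator {-\<epsilon>..0} t \<partial>lborel)"
  proof (rule nn_integral_mono)
    fix t :: real
    consider "t < -\<epsilon>" | "-\<epsilon> \<le> t" "t < 0" | "0 \<le> t" "t \<le> \<epsilon>" | "\<epsilon> < t" by linarith
    then show "ennreal ((max 0 (1 - \<bar>t\<bar> / \<epsilon>))\<^sup>2) \<le> ennreal ((1 - t / \<epsilon>)\<^sup>2) * indicator {0..\<epsilon>} t
           + ennreal ((1 + t / \<epsilon>)\<^sup>2) * indicator {-\<epsilon>..0} t"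
      using assms by cases (auto simp: max_def field_simps)
  qed
  also have "\<dots> = (\<integral>\<^sup>+t. ennreal ((1 - t / \<epsilon>)\<^sup>2) * indicator {0..\<epsilon>} t \<partial>lborel)
           + (\<integral>\<^sup>+t. ennreal ((1 + t / \<epsilon>)\<^sup>2) * indicator {-\<epsilon>..0} t \<partial>lborel)"
    by (rule nn_integral_add) measurable
  also have "(\<integral>\<^sup>+t. ennreal ((1 - t / \<epsilon>)\<^sup>2) * indicator {0..\<epsilon>} t \<partial>lborel)
     = ennreal (- \<epsilon> / 3 * (1 - \<epsilon> / \<epsilon>) ^ 3 - - \<epsilon> / 3 * (1 - 0 / \<epsilon>) ^ 3)"
    using assms
    by (intro nn_integral_FTC_Icc[where F = "\<lambda>t. - \<epsilon> / 3 * (1 - t / \<epsilon>) ^ 3"])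
      (auto intro!: derivative_eq_intros)
  also have "(\<integral>\<^sup>+t. ennreal ((1 + t / \<epsilon>)\<^sup>2) * indicator {-\<epsilon>..0} t \<partial>lborel)
     = ennreal (\<epsilon> / 3 * (1 + 0 / \<epsilon>) ^ 3 - \<epsilon> / 3 * (1 + (-\<epsilon>) / \<epsilon>) ^ 3)"
    using assms
    by (intro nn_integral_FTC_Icc[where F = "\<lambda>t. \<epsilon> / 3 * (1 + t / \<epsilon>) ^ 3"])
      (auto intro!: derivative_eq_intros)
  finally show ?thesis
    using assms by (simp add: ennreal_plus[symmetric] del: ennreal_plus)
qed

section \<open>The approximation error\<close>

text \<open>The difference of the two ReLU terms rises linearly from 0 at \<open>-\<epsilon>\<close>
  to \<open>2 * \<epsilon>\<close> at \<open>\<epsilon>\<close>. The network thus meets the step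
  outside the layer and passes through the mean of the two values at 0, where the error is
  largest.\<close>

lemma two_layer_step_error:
  fixes \<alpha>\<^sub>1 \<alpha>\<^sub>2 \<epsilon> t :: real
  assumes "\<epsilon> > 0"
  shows "((if t < 0 then \<alpha>\<^sub>1 else \<alpha>\<^sub>2) -
      (\<alpha>\<^sub>1 + (\<alpha>\<^sub>2 - \<alpha>\<^sub>1) / (2 * \<epsilon>) * (relu (t + \<epsilon>) - relu (t - \<epsilon>))))\<^sup>2
    = (\<alpha>\<^sub>1 - \<alpha>\<^sub>2)\<^sup>2 / 4 * (max 0 (1 - \<bar>t\<bar> / \<epsilon>))\<^sup>2"
proof -
  consider "t < -\<epsilon>" | "-\<epsilon> \<le> t" "t < 0" | "0 \<le> t" "t \<le> \<epsilon>" | "\<epsilon> < t" by linarith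
  then show ?thesis
    using assms by cases (auto simp: relu_def max_def field_simps power2_eq_square)
qed

lemma relu_bounded_difference: "0 \<le> \<epsilon> \<Longrightarrow> \<bar>relu (t + \<epsilon>) - relu (t - \<epsilon>)\<bar> \<le> 2 * \<epsilon>"
  by (auto simp: relu_def)

text \<open>Existence of the weak derivatives is stated separately so that the claim about all of
  their versions is not vacuous; square integrability is stated because \<open>L2_norm\<close> is
  meaningful only then. The assumption \<open>norm \<xi> \<ge> 1\<close> controls the thickness
  \<open>2 * \<epsilon> / norm \<xi>\<close> of the transition layer.\<close>

theorem lemma3p2:
  fixes \<Omega> \<Omega>\<^sub>1 \<Omega>\<^sub>2 :: "(real ^ 'n) set"
    and \<xi> \<eta> :: "real ^ 'n"
    and c \<alpha>\<^sub>1 \<alpha>\<^sub>2 \<epsilon> D :: real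
    and chi p :: "real ^ 'n \<Rightarrow> real"
  assumes "bounded_lipschitz_domain \<Omega>"
    and "D = diameter \<Omega>"
    and "norm \<xi> \<ge> 1"
    and "\<Omega>\<^sub>1 = {x \<in> \<Omega>. \<xi> \<bullet> x < c}" and "\<Omega>\<^sub>1 \<noteq> {}"
    and "\<Omega>\<^sub>2 = {x \<in> \<Omega>. \<xi> \<bullet> x > c}" and "\<Omega>\<^sub>2 \<noteq> {}"
    and "\<And>x. x \<in> \<Omega>\<^sub>1 \<Longrightarrow> chi x = \<alpha>\<^sub>1"
    and "\<And>x. x \<in> \<Omega>\<^sub>2 \<Longrightarrow> chi x = \<alpha>\<^sub>2"
    and "\<epsilon> > 0"
    and "\<Omega> \<inter> {x. \<xi> \<bullet> x = c + \<epsilon>} \<noteq> {}"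
    and "\<Omega> \<inter> {x. \<xi> \<bullet> x = c - \<epsilon>} \<noteq> {}"
    and "\<And>x. p x = \<alpha>\<^sub>1 + (\<alpha>\<^sub>2 - \<alpha>\<^sub>1) / (2 * \<epsilon>) *
                   (relu (\<xi> \<bullet> x - c + \<epsilon>) - relu (\<xi> \<bullet> x - c - \<epsilon>))"
    and "\<eta> \<bullet> \<xi> = 0"
  shows "square_integrable \<Omega> (\<lambda>x. chi x - p x) \<and>
    (\<exists>chi_eta. has_weak_directional_derivative \<Omega> \<eta> chi chi_eta) \<and>
    (\<exists>p_eta. has_weak_directional_derivative \<Omega> \<eta> p p_eta) \<and>
    (\<forall>chi_eta p_eta. has_weak_directional_derivative \<Omega> \<eta> chi chi_eta \<longrightarrow>
       has_weak_directional_derivative \<Omega> \<eta> p p_eta \<longrightarrow>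
       square_integrable \<Omega> (\<lambda>x. chi_eta x - p_eta x) \<and>
       L2_norm \<Omega> (\<lambda>x. chi x - p x) =
         sqrt ((L2_norm \<Omega> (\<lambda>x. chi x - p x))\<^sup>2 + (L2_norm \<Omega> (\<lambda>x. chi_eta x - p_eta x))\<^sup>2)) \<and>
    L2_norm \<Omega> (\<lambda>x. chi x - p x) \<le>
      1 / sqrt 6 * D powr ((real CARD('n) - 1) / 2) * \<bar>\<alpha>\<^sub>1 - \<alpha>\<^sub>2\<bar> * sqrt \<epsilon>"
proof -
  have \<Omega>: "open \<Omega>" "bounded \<Omega>"
    using assms(1) by (auto simp: bounded_lipschitz_domain_def)
  have \<Omega>_borel: "\<Omega> \<in> sets borel"
    using \<Omega>(1) by (rule borel_open)
  have \<xi>: "norm \<xi> \<ge> 1" and \<epsilon>: "\<epsilon> > 0" and \<eta>: "\<eta> \<bullet> \<xi> = 0"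
    using assms by auto

  \<comment> \<open>Reduction to ridge functions\<close>
  define g where "g t = (if t - c < 0 then \<alpha>\<^sub>1 else \<alpha>\<^sub>2)" for t
  define k where "k t = \<alpha>\<^sub>1 + (\<alpha>\<^sub>2 - \<alpha>\<^sub>1) / (2 * \<epsilon>) * (relu (t - c + \<epsilon>) - relu (t - c - \<epsilon>))" for t
  have [measurable]: "g \<in> borel_measurable borel"
    unfolding g_def by measurable
  have [measurable]: "k \<in> borel_measurable borel"
    unfolding k_def relu_def by measurable
  have g_bound: "\<bar>g t\<bar> \<le> \<bar>\<alpha>\<^sub>1\<bar> + \<bar>\<alpha>\<^sub>2\<bar>" for t
    by (simp add: g_def)
  have k_bound: "\<bar>k t\<bar> \<le> \<bar>\<alpha>\<^sub>1\<bar> + \<bar>\<alpha>\<^sub>2 - \<alpha>\<^sub>1\<bar>" for t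
  proof -
    let ?r = "(\<alpha>\<^sub>2 - \<alpha>\<^sub>1) / (2 * \<epsilon>) * (relu (t - c + \<epsilon>) - relu (t - c - \<epsilon>))"
    have "\<bar>?r\<bar> \<le> \<bar>(\<alpha>\<^sub>2 - \<alpha>\<^sub>1) / (2 * \<epsilon>)\<bar> * (2 * \<epsilon>)"
      unfolding abs_mult using \<epsilon> by (intro mult_left_mono relu_bounded_difference) auto
    also have "\<dots> = \<bar>\<alpha>\<^sub>2 - \<alpha>\<^sub>1\<bar>"
      using \<epsilon> by simp
    finally show ?thesis
      unfolding k_def by linarith
  qed
  have p: "p x = k (\<xi> \<bullet> x)" for x
    using assms(13) by (simp add: k_def)
  \<comment> \<open>The values of \<open>chi\<close> on the hyperplane are unconstrained; as a null
    set it does not affect the agreement with \<open>g\<close>, whose value at \<open>c\<close> is a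
    mere choice.\<close>
  have "negligible {x. \<xi> \<bullet> x = c}"
    using \<xi> by (intro negligible_hyperplane) auto
  then have "AE x in lebesgue. x \<notin> {x. \<xi> \<bullet> x = c}"
    by (intro AE_not_in) (simp add: negligible_iff_null_sets)
  then have chi: "AE x in lebesgue. x \<in> \<Omega> \<longrightarrow> chi x = g (\<xi> \<bullet> x)"
  proof eventually_elim
    case (elim x)
    then consider "\<xi> \<bullet> x < c" | "\<xi> \<bullet> x > c" by force
    then show ?case
      using assms(4,6,8,9) by cases (auto simp: g_def)
  qed
  have p': "AE x in lebesgue. x \<in> \<Omega> \<longrightarrow> p x = k (\<xi> \<bullet> x)"
    by (simp add: p)
  have weak_chi: "has_weak_directional_derivative \<Omega> \<eta> chi (\<lambda>_. 0)"
    by (rule ridge_has_weak_directional_derivative[OF _ g_bound chi \<eta>]) measurable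
  have weak_p: "has_weak_directional_derivative \<Omega> \<eta> p (\<lambda>_. 0)"
    by (rule ridge_has_weak_directional_derivative[OF _ k_bound p' \<eta>]) measurable

  \<comment> \<open>The squared error as a function of \<open>\<xi> \<bullet> x\<close>\<close>
  define e where "e t = (\<alpha>\<^sub>1 - \<alpha>\<^sub>2)\<^sup>2 / 4 * (max 0 (1 - \<bar>t - c\<bar> / \<epsilon>))\<^sup>2" for t
  have [measurable]: "e \<in> borel_measurable borel"
    unfolding e_def by measurable
  have e: "(g t - k t)\<^sup>2 = e t" for t
    using two_layer_step_error[OF \<epsilon>, of "t - c" \<alpha>\<^sub>1 \<alpha>\<^sub>2] by (simp add: g_def k_def e_def)
  have e_bound: "\<bar>e t\<bar> \<le> (\<alpha>\<^sub>1 - \<alpha>\<^sub>2)\<^sup>2 / 4" for t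
  proof -
    have "(max 0 (1 - \<bar>t - c\<bar> / \<epsilon>))\<^sup>2 \<le> 1"
      using \<epsilon> by (intro power_le_one) auto
    then show ?thesis
      unfolding e_def abs_mult by (simp add: mult_left_le)
  qed
  have diff: "AE x in lebesgue. x \<in> \<Omega> \<longrightarrow> chi x - p x = g (\<xi> \<bullet> x) - k (\<xi> \<bullet> x)"
    using chi by eventually_elim (simp add: p)
  have sq: "AE x in lebesgue. x \<in> \<Omega> \<longrightarrow> (chi x - p x)\<^sup>2 = e (\<xi> \<bullet> x)"
    using diff by eventually_elim (simp add: e)
  have gk_bound: "\<bar>g t - k t\<bar> \<le> \<bar>\<alpha>\<^sub>1\<bar> + \<bar>\<alpha>\<^sub>2\<bar> + (\<bar>\<alpha>\<^sub>1\<bar> + \<bar>\<alpha>\<^sub>2 - \<alpha>\<^sub>1\<bar>)" for t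
    using g_bound[of t] k_bound[of t] by linarith
  have square_int: "square_integrable \<Omega> (\<lambda>x. chi x - p x)"
    unfolding square_integrable_def
  proof
    show "set_borel_measurable lebesgue \<Omega> (\<lambda>x. chi x - p x)"
      by (rule ridge_integrable_on(1)[OF \<Omega>_borel \<Omega>(2) _ gk_bound diff]) measurable
    show "set_integrable lebesgue \<Omega> (\<lambda>x. (chi x - p x)\<^sup>2)"
      by (rule ridge_integrable_on(2)[OF \<Omega>_borel \<Omega>(2) _ e_bound sq]) measurable
  qed

  \<comment> \<open>The quantitative bound\<close>
  have D: "D > 0"
  proof -
    obtain x y where xy: "x \<in> \<Omega>" "y \<in> \<Omega>" "\<xi> \<bullet> x < c" "\<xi> \<bullet> y > c"
      using assms(4-7) by blast
    then have "0 < dist x y" by auto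
    also have "\<dots> \<le> D"
      using diameter_bounded_bound[OF \<Omega>(2) xy(1,2)] assms(2) by simp
    finally show ?thesis .
  qed
  define u where "u = \<xi> /\<^sub>R norm \<xi>"
  have u: "norm u = 1" "\<xi> = norm \<xi> *\<^sub>R u"
  proof -
    have "norm \<xi> \<noteq> 0" using \<xi> by linarith
    then show "norm u = 1" "\<xi> = norm \<xi> *\<^sub>R u"
      unfolding u_def by simp_all
  qed
  have inner_\<xi>: "\<xi> \<bullet> x = norm \<xi> * (u \<bullet> x)" for x
    by (subst u(2)) (rule inner_scaleR_left)
  let ?hat = "\<lambda>t. ennreal ((max 0 (1 - \<bar>t\<bar> / \<epsilon>))\<^sup>2)"
  let ?n = "CARD('n) - 1"
  \<comment> \<open>Substituting t = \<open>norm \<xi> * s - c\<close> costs a factor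
    \<open>1 / norm \<xi>\<close>, which is at most 1.\<close>
  have "(\<integral>\<^sup>+s. ?hat (- c + norm \<xi> * s) \<partial>lborel) \<le> ennreal \<bar>norm \<xi>\<bar> * (\<integral>\<^sup>+s. ?hat (- c + norm \<xi> * s) \<partial>lborel)"
    using mult_right_mono[of 1 "ennreal \<bar>norm \<xi>\<bar>" "\<integral>\<^sup>+s. ?hat (- c + norm \<xi> * s) \<partial>lborel"] \<xi>
    by simp
  also have "\<dots> = (\<integral>\<^sup>+t. ?hat t \<partial>lborel)"
    using \<xi> by (intro nn_integral_real_affine[symmetric]) auto
  also have "\<dots> \<le> ennreal (2 * \<epsilon> / 3)"
    by (rule hat_square_integral_le[OF \<epsilon>])
  finally have hat: "(\<integral>\<^sup>+s. ?hat (- c + norm \<xi> * s) \<partial>lborel) \<le> ennreal (2 * \<epsilon> / 3)" .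
  have "(\<integral>\<^sup>+s. ennreal (e (norm \<xi> * s)) \<partial>lborel)
      = ennreal ((\<alpha>\<^sub>1 - \<alpha>\<^sub>2)\<^sup>2 / 4) * (\<integral>\<^sup>+s. ?hat (- c + norm \<xi> * s) \<partial>lborel)"
    by (subst nn_integral_cmult[symmetric]) (simp_all add: e_def ennreal_mult'[symmetric])
  also have "\<dots> \<le> ennreal ((\<alpha>\<^sub>1 - \<alpha>\<^sub>2)\<^sup>2 / 4) * ennreal (2 * \<epsilon> / 3)"
    by (rule mult_left_mono[OF hat]) simp
  finally have e_int: "(\<integral>\<^sup>+s. ennreal (e (norm \<xi> * s)) \<partial>lborel) \<le> ennreal ((\<alpha>\<^sub>1 - \<alpha>\<^sub>2)\<^sup>2 / 4 * (2 * \<epsilon> / 3))"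
    by (subst ennreal_mult') simp_all
  have "(\<integral>\<^sup>+x. ennreal (indicator \<Omega> x *\<^sub>R (chi x - p x)\<^sup>2) \<partial>lebesgue)
      = (\<integral>\<^sup>+x. indicator \<Omega> x * ennreal (e (\<xi> \<bullet> x)) \<partial>lebesgue)"
    using sq by (intro nn_integral_cong_AE, eventually_elim) (auto split: split_indicator)
  also have "\<dots> = (\<integral>\<^sup>+x. indicator \<Omega> x * ennreal (e (norm \<xi> * (u \<bullet> x))) \<partial>lborel)"
    unfolding nn_integral_completion inner_\<xi> ..
  also have "\<dots> \<le> ennreal (diameter \<Omega>) ^ ?n * (\<integral>\<^sup>+s. ennreal (e (norm \<xi> * s)) \<partial>lborel)"
    by (rule nn_integral_slice_le[OF \<Omega>_borel \<Omega>(2) _ u(1)]) measurable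
  also have "\<dots> \<le> ennreal D ^ ?n * ennreal ((\<alpha>\<^sub>1 - \<alpha>\<^sub>2)\<^sup>2 / 4 * (2 * \<epsilon> / 3))"
    using e_int assms(2) by (intro mult_mono) auto
  also have "\<dots> = ennreal (D ^ ?n * ((\<alpha>\<^sub>1 - \<alpha>\<^sub>2)\<^sup>2 / 4 * (2 * \<epsilon> / 3)))"
    using D by (simp add: ennreal_power flip: ennreal_mult')
  finally have "(LINT x:\<Omega>|lebesgue. (chi x - p x)\<^sup>2) \<le> D ^ ?n * ((\<alpha>\<^sub>1 - \<alpha>\<^sub>2)\<^sup>2 / 4 * (2 * \<epsilon> / 3))"
    unfolding set_lebesgue_integral_def using D \<epsilon> by (intro integral_real_bounded) auto
  \<comment> \<open>The constant arises as 1/4 * 2/3 = 1/6, from the squared half jump and the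
    integral of the squared hat.\<close>
  also have "\<dots> = (1 / sqrt 6 * D powr ((real CARD('n) - 1) / 2) * \<bar>\<alpha>\<^sub>1 - \<alpha>\<^sub>2\<bar> * sqrt \<epsilon>)\<^sup>2"
  proof -
    have "(D powr ((real CARD('n) - 1) / 2))\<^sup>2 = D powr (real CARD('n) - 1)"
      by (simp add: power2_eq_square flip: powr_add)
    also have "\<dots> = D powr real ?n"
      by (simp add: of_nat_diff)
    \<comment> \<open>Positivity of \<open>D\<close> matters in dimension one, since
      \<open>0 powr 0\<close> is 0 while \<open>0 ^ 0\<close> is 1.\<close>
    also have "\<dots> = D ^ ?n"
      using D by (rule powr_realpow)
    finally show ?thesis
      using \<epsilon> by (simp add: power_mult_distrib power_divide)
  qed
  finally have bound: "L2_norm \<Omega> (\<lambda>x. chi x - p x) \<le>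
      1 / sqrt 6 * D powr ((real CARD('n) - 1) / 2) * \<bar>\<alpha>\<^sub>1 - \<alpha>\<^sub>2\<bar> * sqrt \<epsilon>"
    unfolding L2_norm_def using \<epsilon> by (intro real_le_lsqrt) (auto simp: set_lebesgue_integral_def)

  \<comment> \<open>The tangential derivatives\<close>
  have derivs: "square_integrable \<Omega> (\<lambda>x. chi_eta x - p_eta x) \<and>
       L2_norm \<Omega> (\<lambda>x. chi x - p x) =
         sqrt ((L2_norm \<Omega> (\<lambda>x. chi x - p x))\<^sup>2 + (L2_norm \<Omega> (\<lambda>x. chi_eta x - p_eta x))\<^sup>2)"
    if w: "has_weak_directional_derivative \<Omega> \<eta> chi chi_eta" "has_weak_directional_derivative \<Omega> \<eta> p p_eta"
    for chi_eta p_eta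
  proof -
    have "AE x in lebesgue. x \<in> \<Omega> \<longrightarrow> chi_eta x = 0"
      by (rule zero_weak_directional_derivative_unique[OF \<Omega>(1) weak_chi w(1)])
    moreover have "AE x in lebesgue. x \<in> \<Omega> \<longrightarrow> p_eta x = 0"
      by (rule zero_weak_directional_derivative_unique[OF \<Omega>(1) weak_p w(2)])
    ultimately have zero: "AE x in lebesgue. x \<in> \<Omega> \<longrightarrow> chi_eta x - p_eta x = 0"
      by eventually_elim simp
    then have zero2: "AE x in lebesgue. x \<in> \<Omega> \<longrightarrow> (chi_eta x - p_eta x)\<^sup>2 = 0"
      by eventually_elim simp
    have "square_integrable \<Omega> (\<lambda>x. chi_eta x - p_eta x)"
      unfolding square_integrable_def
      using ridge_integrable_on(1)[OF \<Omega>_borel \<Omega>(2), of "\<lambda>_. 0" 0, OF _ _ zero]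
        ridge_integrable_on(2)[OF \<Omega>_borel \<Omega>(2), of "\<lambda>_. 0" 0, OF _ _ zero2] by simp
    moreover have "(LINT x:\<Omega>|lebesgue. (chi_eta x - p_eta x)\<^sup>2) = 0"
      unfolding set_lebesgue_integral_def
      using zero2 by (intro integral_eq_zero_AE, eventually_elim) (auto split: split_indicator)
    then have "L2_norm \<Omega> (\<lambda>x. chi_eta x - p_eta x) = 0"
      by (simp add: L2_norm_def)
    moreover have "L2_norm \<Omega> (\<lambda>x. chi x - p x) \<ge> 0"
      by (auto simp: L2_norm_def set_lebesgue_integral_def)
    ultimately show ?thesis
      by simp
  qed
  show ?thesis
    using square_int weak_chi weak_p derivs bound by blast
qed

end
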